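(* Let $p$ be a prime, let $k \geq 1$ be an integer with $p \geq k+2$, and let $n$ be a non-negative integer with $n \leq p-1$. Suppose that the monomial $x^n$ is $k$-PN over $\mathbb{F}_p$. Then $n = k+1$.
   Context: $\mathbb{F}_q$ denotes the finite field with $q$ elements. For a polynomial $f \in \mathbb{F}_q[x]$ and $a_1,\dots,a_k \in \mathbb{F}_q$, the $k$-th finite difference of $f$ in directions $(a_1,\dots,a_k)$ is defined recursively by $\nabla_{a}^1 f = f(x+a)-f(x)$ and $\nabla_{a_1,\dots,a_k}^k f = g(x+a_k)-g(x)$, where $g(x) = \nabla_{a_1,\dots,a_{k-1}}^{k-1} f$. The polynomial $f$ is called $k$-PN over $\mathbb{F}_q$ if, for every choice of $(a_1,\dots,a_k)$ with all $a_i \in \mathbb{F}_q$ and $a_i \neq 0$, the function $\mathbb{F}_q \to \mathbb{F}_q$ associated to $\nabla_{a_1,\dots,a_k}^k f$ is a bijection. *)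

theory Defs
  imports "HOL-Computational_Algebra.Computational_Algebra" "HOL-Library.Cardinality"
begin

text \<open>
  The \<open>k\<close>-th finite difference in directions \<open>(a 1, \<dots>, a k)\<close>, as a polynomial.
  Only the values of \<open>a\<close> on \<open>{1..k}\<close> matter.  The recursion is started at \<open>k = 0\<close>
  with \<open>f\<close> itself, so that \<open>k = 1\<close> yields \<open>f (x + a 1) - f x\<close>.
\<close>
primrec fin_diff :: "nat \<Rightarrow> (nat \<Rightarrow> 'a) \<Rightarrow> 'a poly \<Rightarrow> 'a::comm_ring_1 poly" where
  "fin_diff 0 a f = f"
| "fin_diff (Suc k) a f = fin_diff k a f \<circ>\<^sub>p [:a (Suc k), 1:] - fin_diff k a f"

definition k_PN :: "nat \<Rightarrow> 'a::{field, finite} poly \<Rightarrow> bool" where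
  "k_PN k f \<longleftrightarrow> (\<forall>a. (\<forall>i\<in>{1..k}. a i \<noteq> 0) \<longrightarrow> bij (poly (fin_diff k a f)))"

end

theory Submission
  imports Defs
begin

text \<open>
  Differencing lowers the degree of a polynomial of degree less than \<open>p\<close> by exactly one, and
  \<open>k - 1\<close> differences of a \<open>k\<close>-PN polynomial give a planar one, so it suffices that a planar
  polynomial \<open>f\<close> over \<open>F\<^sub>p\<close> of degree \<open>d \<le> p - 1\<close> has \<open>d = 2\<close>.

  If \<open>g\<close> is planar with moments \<open>M r = \<Sum>x. g x ^ r\<close>, then the sum of \<open>(g x - g y) ^ s\<close> over all
  \<open>x, y\<close> vanishes for \<open>s < p - 1\<close>; expanding it for \<open>s = 2 * r\<close> gives \<open>M r = 0\<close> whenever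
  \<open>2 * r < p - 1\<close>, by induction on \<open>r\<close>. Applying this to \<open>g x = f x + b * x\<close> for all \<open>b\<close> and comparing
  coefficients of powers of \<open>b\<close> gives \<open>(\<Sum>x. f x ^ i * x ^ j) = 0\<close> for \<open>2 * (i + j) < p - 1\<close>. On the
  other hand this sum is nonzero when \<open>i * d + j = p - 1\<close>, since it picks out a leading coefficient.
  Taking \<open>i = 1\<close> yields \<open>d \<le> (p + 1) / 2\<close>, and Euclidean division of \<open>p - 1\<close> by \<open>d\<close> excludes
  \<open>3 \<le> d \<le> (p - 1) / 2\<close>. If \<open>d = (p + 1) / 2\<close> and \<open>p > 3\<close>, then \<open>f (x + 1) - f x\<close> has a square of
  degree \<open>p - 1\<close>, so it cannot be a bijection.
\<close>

section \<open>Power sums over a finite field\<close>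

lemma power_card_minus_1_eq_1:
  fixes x :: "'a::{field, finite}"
  assumes "x \<noteq> 0"
  shows "x ^ (CARD('a) - 1) = 1"
proof -
  have "(\<Prod>y\<in>UNIV - {0}. x * y) = (\<Prod>y\<in>UNIV - {0::'a}. y)"
    by (rule prod.reindex_bij_witness[of _ "\<lambda>y. y / x" "\<lambda>y. x * y"]) (use assms in auto)
  then have "x ^ card (UNIV - {0::'a}) * (\<Prod>y\<in>UNIV - {0::'a}. y) = (\<Prod>y\<in>UNIV - {0::'a}. y)"
    by (simp add: prod.distrib)
  moreover have "(\<Prod>y\<in>UNIV - {0::'a}. y) \<noteq> 0"
    by simp
  ultimately show ?thesis
    by (simp add: card_Diff_singleton)
qed

lemma of_nat_card_eq_0: "of_nat CARD('a::{field, finite}) = (0::'a)"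
proof -
  have "(\<Sum>x\<in>UNIV. x + 1) = (\<Sum>x\<in>UNIV. x :: 'a)"
    by (rule sum.reindex_bij_witness[of _ "\<lambda>x. x - 1" "\<lambda>x. x + 1"]) auto
  then show ?thesis
    by (simp add: sum.distrib)
qed

lemma card_ge_2: "CARD('a::{field, finite}) \<ge> 2"
  using card_mono[of UNIV "{0, 1::'a}"] by simp

lemma of_nat_eq_0_iff_prime_card:
  assumes "prime CARD('a::{field, finite})"
  shows "of_nat m = (0::'a) \<longleftrightarrow> CARD('a) dvd m"
proof -
  have "CHAR('a) = CARD('a)"
    using of_nat_card_eq_0[where 'a = 'a] assms CHAR_not_1[where 'a = 'a]
    by (metis One_nat_def prime_nat_iff of_nat_eq_0_iff_char_dvd)
  then show ?thesis
    by (metis of_nat_eq_0_iff_char_dvd)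
qed

text \<open>The binomial coefficient divides \<open>fact n\<close>, which has no factor
  \<open>p\<close> for \<open>n < p\<close>.\<close>

lemma of_nat_choose_neq_0:
  assumes "prime CARD('a::{field, finite})" "n < CARD('a)" "k \<le> n"
  shows "of_nat (n choose k) \<noteq> (0::'a)"
proof -
  have "\<not> CARD('a) dvd (n choose k)"
    by (metis assms binomial_fact_lemma dvd_mult linorder_not_less prime_dvd_fact_iff)
  then show ?thesis
    using assms by (simp add: of_nat_eq_0_iff_prime_card)
qed

text \<open>For \<open>r > 0\<close>, \<open>x ^ r = 1\<close> has too few roots to hold for all
  nonzero \<open>x\<close>. Substituting \<open>a * x\<close> with \<open>a ^ r \<noteq> 1\<close>
  multiplies the sum by \<open>a ^ r\<close> without changing it.\<close>

lemma sum_power_eq_0: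
  assumes "r < CARD('a::{field, finite}) - 1"
  shows "(\<Sum>x\<in>UNIV. (x::'a) ^ r) = 0"
proof (cases "r = 0")
  case True
  then show ?thesis by (simp add: of_nat_card_eq_0)
next
  case False
  let ?p = "monom 1 r - 1 :: 'a poly"
  have "coeff ?p r = 1"
    using False by (simp add: coeff_1)
  then have "?p \<noteq> 0"
    by (metis coeff_0 zero_neq_one)
  moreover have "degree ?p \<le> r"
    by (simp add: degree_diff_le degree_monom_le)
  ultimately have "card {x. poly ?p x = 0} \<le> r"
    using card_poly_roots_bound[of ?p] by linarith
  moreover have "card (UNIV - {0::'a}) = CARD('a) - 1"
    by (simp add: card_Diff_singleton)
  ultimately have "\<not> UNIV - {0::'a} \<subseteq> {x. poly ?p x = 0}"
    using card_mono[of "{x. poly ?p x = 0}" "UNIV - {0::'a}"] assms by auto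
  then obtain a :: 'a where a: "a \<noteq> 0" "a ^ r \<noteq> 1"
    by (auto simp: poly_monom)
  have "(\<Sum>x\<in>UNIV. (a * x) ^ r) = (\<Sum>x\<in>UNIV. x ^ r)"
    by (rule sum.reindex_bij_witness[of _ "\<lambda>y. y / a" "\<lambda>y. a * y"]) (use a in auto)
  then have "a ^ r * (\<Sum>x\<in>UNIV. x ^ r) = (\<Sum>x\<in>UNIV. x ^ r)"
    by (simp add: power_mult_distrib sum_distrib_left)
  then show ?thesis
    using a by simp
qed

lemma sum_power_card_minus_1: "(\<Sum>x\<in>UNIV. (x::'a::{field, finite}) ^ (CARD('a) - 1)) = -1"
proof -
  have "(\<Sum>x\<in>UNIV. (x::'a) ^ (CARD('a) - 1)) = (\<Sum>x\<in>UNIV - {0}. x ^ (CARD('a) - 1))"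
    using card_ge_2[where 'a = 'a] by (intro sum.mono_neutral_right) auto
  also have "\<dots> = (\<Sum>x\<in>UNIV - {0::'a}. 1)"
    by (intro sum.cong power_card_minus_1_eq_1) auto
  also have "\<dots> = of_nat (CARD('a) - 1)"
    by (simp add: card_Diff_singleton)
  also have "\<dots> = -1"
    using card_ge_2[where 'a = 'a] of_nat_card_eq_0[where 'a = 'a] by (simp add: of_nat_diff)
  finally show ?thesis .
qed

text \<open>Of the power sums with exponent up to \<open>CARD('a) - 1\<close>, only the last
  survives, with value -1.\<close>

lemma sum_poly_eq:
  fixes f :: "'a::{field, finite} poly"
  assumes "degree f \<le> CARD('a) - 1"
  shows "(\<Sum>x\<in>UNIV. poly f x) = - coeff f (CARD('a) - 1)"
proof -
  have "(\<Sum>x\<in>UNIV. poly f x) = (\<Sum>x\<in>UNIV. \<Sum>i\<le>CARD('a) - 1. coeff f i * x ^ i)"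
  proof (intro sum.cong refl)
    fix x :: 'a
    show "poly f x = (\<Sum>i\<le>CARD('a) - 1. coeff f i * x ^ i)"
      unfolding poly_altdef using assms
      by (intro sum.mono_neutral_left) (auto simp: coeff_eq_0)
  qed
  also have "\<dots> = (\<Sum>i\<le>CARD('a) - 1. coeff f i * (\<Sum>x\<in>UNIV. x ^ i))"
    by (subst sum.swap) (simp add: sum_distrib_left)
  also have "\<dots> = (\<Sum>i\<le>CARD('a) - 1. if i = CARD('a) - 1 then - coeff f i else 0)"
    by (intro sum.cong refl) (auto simp: sum_power_eq_0 sum_power_card_minus_1 simp flip: One_nat_def)
  finally show ?thesis
    by simp
qed

section \<open>Moments of planar functions\<close>

lemma planar_moment_eq_0:
  fixes g :: "'a::{field, finite} \<Rightarrow> 'a"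
  assumes prime: "prime CARD('a)"
    and planar: "\<And>a. a \<noteq> 0 \<Longrightarrow> bij (\<lambda>x. g (x + a) - g x)"
    and "2 * r < CARD('a) - 1"
  shows "(\<Sum>x\<in>UNIV. g x ^ r) = 0"
  using \<open>2 * r < CARD('a) - 1\<close>
proof (induction r rule: less_induct)
  case (less r)
  define M where "M i = (\<Sum>x\<in>UNIV. g x ^ i)" for i
  let ?s = "\<Sum>y\<in>UNIV. \<Sum>x\<in>UNIV. (g x - g y) ^ (2 * r)"
  have "?s = (\<Sum>y\<in>UNIV. \<Sum>a\<in>UNIV. (g (y + a) - g y) ^ (2 * r))"
  proof (rule sum.cong[OF refl])
    fix y
    show "(\<Sum>x\<in>UNIV. (g x - g y) ^ (2 * r)) = (\<Sum>a\<in>UNIV. (g (y + a) - g y) ^ (2 * r))"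
      by (rule sum.reindex_bij_witness[of _ "\<lambda>a. y + a" "\<lambda>x. x - y"]) auto
  qed
  also have "\<dots> = (\<Sum>a\<in>UNIV. \<Sum>y\<in>UNIV. (g (y + a) - g y) ^ (2 * r))"
    by (rule sum.swap)
  also have "\<dots> = 0"
  proof (rule sum.neutral, rule ballI)
    fix a :: 'a
    show "(\<Sum>y\<in>UNIV. (g (y + a) - g y) ^ (2 * r)) = 0"
    proof (cases "a = 0")
      case True
      then show ?thesis by (cases "r = 0") (simp_all add: of_nat_card_eq_0)
    next
      case False
      then have "(\<Sum>y\<in>UNIV. (g (y + a) - g y) ^ (2 * r)) = (\<Sum>z\<in>UNIV. z ^ (2 * r))"
        by (intro sum.reindex_bij_betw planar)
      then show ?thesis
        using less.prems by (simp add: sum_power_eq_0)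
    qed
  qed
  finally have "?s = 0" .
  have "?s = (\<Sum>y\<in>UNIV. \<Sum>x\<in>UNIV. \<Sum>i\<le>2*r. of_nat (2*r choose i) * g x ^ i * (- g y) ^ (2*r - i))"
    by (simp only: diff_conv_add_uminus binomial_ring)
  also have "\<dots> = (\<Sum>i\<le>2*r. \<Sum>y\<in>UNIV. \<Sum>x\<in>UNIV. of_nat (2*r choose i) * g x ^ i * (- g y) ^ (2*r - i))"
    by (subst sum.swap, subst (2) sum.swap) (rule refl)
  also have "\<dots> = (\<Sum>i\<le>2*r. of_nat (2*r choose i) * (-1) ^ (2*r - i) * M i * M (2*r - i))"
    unfolding M_def
    by (rule sum.cong[OF refl], subst sum.swap)
       (simp add: sum_distrib_left sum_distrib_right power_minus[of "g _"] mult_ac)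
  \<comment> \<open>If \<open>i \<noteq> r\<close>, one of \<open>i\<close> and
    \<open>2*r - i\<close> is below \<open>r\<close>, so the induction hypothesis kills the
    term.\<close>
  also have "\<dots> = (\<Sum>i\<in>{r}. of_nat (2*r choose i) * (-1) ^ (2*r - i) * M i * M (2*r - i))"
  proof (intro sum.mono_neutral_right ballI)
    fix i assume i: "i \<in> {..2*r} - {r}"
    then consider "i < r" | "2 * r - i < r" by fastforce
    then have "M i = 0 \<or> M (2*r - i) = 0"
      unfolding M_def by cases (use less in auto)
    then show "of_nat (2*r choose i) * (-1) ^ (2*r - i) * M i * M (2*r - i) = 0"
      by auto
  qed auto
  finally have "of_nat (2*r choose r) * (-1) ^ r * M r * M r = 0"
    using \<open>?s = 0\<close> by (simp add: mult_2)
  moreover have "of_nat (2*r choose r) \<noteq> (0::'a)"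
    using less.prems by (intro of_nat_choose_neq_0 prime) auto
  ultimately show ?case
    by (simp add: M_def)
qed

lemma planar_mixed_moment_eq_0:
  fixes f :: "'a::{field, finite} \<Rightarrow> 'a"
  assumes prime: "prime CARD('a)"
    and planar: "\<And>a. a \<noteq> 0 \<Longrightarrow> bij (\<lambda>x. f (x + a) - f x)"
    and ij: "2 * (i + j) < CARD('a) - 1"
  shows "(\<Sum>x\<in>UNIV. f x ^ i * x ^ j) = 0"
proof -
  \<comment> \<open>\<open>P\<close> is the moment of order \<open>i + j\<close> of
    \<open>b * x + f x\<close>, as a polynomial in \<open>b\<close>.\<close>
  define c where "c l = of_nat (i + j choose l) * (\<Sum>x\<in>UNIV. f x ^ (i + j - l) * x ^ l)" for l
  define P where "P = (\<Sum>l\<le>i + j. monom (c l) l)"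
  have "poly P b = 0" for b
  proof -
    \<comment> \<open>The linear term only shifts each difference by the constant
      \<open>b * a\<close>.\<close>
    have "bij (\<lambda>x. (b * (x + a) + f (x + a)) - (b * x + f x))" if "a \<noteq> 0" for a
    proof -
      have "bij ((\<lambda>z. b * a + z) \<circ> (\<lambda>x. f (x + a) - f x))"
        by (intro bij_comp planar that) (rule bij_betw_byWitness[where f' = "\<lambda>z. z - b * a"], auto)
      then show ?thesis
        by (simp add: o_def algebra_simps)
    qed
    then have "(\<Sum>x\<in>UNIV. (b * x + f x) ^ (i + j)) = 0"
      using planar_moment_eq_0[of "\<lambda>x. b * x + f x" "i + j"] prime ij by blast
    also have "(\<Sum>x\<in>UNIV. (b * x + f x) ^ (i + j))
        = (\<Sum>l\<le>i + j. \<Sum>x\<in>UNIV. of_nat (i + j choose l) * (b * x) ^ l * f x ^ (i + j - l))"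
      unfolding binomial_ring by (rule sum.swap)
    also have "\<dots> = poly P b"
      by (simp add: P_def c_def poly_sum poly_monom sum_distrib_left sum_distrib_right
          power_mult_distrib mult_ac)
    finally show ?thesis by simp
  qed
  moreover have "degree P \<le> i + j"
    unfolding P_def by (intro degree_sum_le) (auto intro: order.trans[OF degree_monom_le])
  \<comment> \<open>\<open>P\<close> has \<open>CARD('a)\<close> roots, more than its degree
    allows.\<close>
  ultimately have "P = 0"
    using card_poly_roots_bound[of P] ij by fastforce
  moreover have "coeff P j = c j"
    by (simp add: P_def coeff_sum)
  ultimately have "c j = 0" by simp
  moreover have "of_nat (i + j choose j) \<noteq> (0::'a)"
    using ij by (intro of_nat_choose_neq_0 prime) auto
  ultimately show ?thesis
    by (simp add: c_def)
qed

section \<open>Degrees of differences\<close>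

lemma degree_difference:
  fixes f :: "'a::{field, finite} poly"
  assumes "prime CARD('a)" "degree f < CARD('a)" "b \<noteq> 0"
  shows "degree (f \<circ>\<^sub>p [:b, 1:] - f) = degree f - 1"
proof (cases "degree f = 0")
  case True
  then show ?thesis by (auto elim!: degree_eq_zeroE)
next
  case False
  define n where "n = degree f"
  have c: "coeff (f \<circ>\<^sub>p [:b, 1:]) j = (\<Sum>i\<le>n. coeff f i * (of_nat (i choose j) * b ^ (i - j)))" for j
  proof -
    have "f \<circ>\<^sub>p [:b, 1:] = (\<Sum>i\<le>n. smult (coeff f i) ([:b, 1:] ^ i))"
      by (simp add: pcompose_altdef poly_altdef degree_map_poly coeff_map_poly n_def)
    moreover have "coeff ([:b, 1:] ^ i) j = of_nat (i choose j) * b ^ (i - j)" for i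
      by (cases "j \<le> i")
         (simp_all add: coeff_linear_poly_power coeff_eq_0 degree_linear_power binomial_eq_0)
    ultimately show ?thesis
      by (simp add: coeff_sum)
  qed
  show ?thesis
  proof (rule antisym)
    show "degree (f \<circ>\<^sub>p [:b, 1:] - f) \<le> degree f - 1"
    proof (rule degree_le, intro allI impI)
      fix j assume "degree f - 1 < j"
      then have j: "j \<ge> n" by (simp add: n_def)
      have "coeff (f \<circ>\<^sub>p [:b, 1:]) j = (\<Sum>i\<le>n. if i = j then coeff f i else 0)"
        unfolding c using j by (intro sum.cong refl) (auto simp: binomial_eq_0)
      also have "\<dots> = coeff f j"
        using j by (auto simp: n_def coeff_eq_0)
      finally show "coeff (f \<circ>\<^sub>p [:b, 1:] - f) j = 0" by simp
    qed
    \<comment> \<open>The coefficient just below the cancelled top one is \<open>n * b\<close> times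
      the leading coefficient of \<open>f\<close>, and \<open>0 < n < p\<close>.\<close>
    obtain m where m: "n = Suc m"
      using False by (cases n) (auto simp: n_def)
    have "coeff (f \<circ>\<^sub>p [:b, 1:]) m
        = (\<Sum>i\<in>{m, n}. coeff f i * (of_nat (i choose m) * b ^ (i - m)))"
      unfolding c using m by (intro sum.mono_neutral_right) (auto simp: binomial_eq_0)
    also have "\<dots> = coeff f m + coeff f n * (of_nat n * b)"
      by (simp add: m)
    finally have "coeff (f \<circ>\<^sub>p [:b, 1:] - f) m = coeff f n * (of_nat n * b)" by simp
    moreover have "of_nat n \<noteq> (0::'a)"
      using assms m unfolding of_nat_eq_0_iff_prime_card[OF assms(1)] n_def
      by (auto dest: dvd_imp_le)
    moreover have "coeff f n \<noteq> 0"
      using False by (auto simp: n_def)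
    ultimately have "coeff (f \<circ>\<^sub>p [:b, 1:] - f) m \<noteq> 0"
      using assms by simp
    then show "degree f - 1 \<le> degree (f \<circ>\<^sub>p [:b, 1:] - f)"
      using m le_degree by (fastforce simp: n_def)
  qed
qed

section \<open>Planar polynomials are quadratic\<close>

theorem planar_poly_degree:
  fixes f :: "'a::{field, finite} poly"
  assumes prime: "prime CARD('a)" and "CARD('a) > 2"
    and deg: "degree f \<le> CARD('a) - 1"
    and planar: "\<And>a. a \<noteq> 0 \<Longrightarrow> bij (\<lambda>x. poly f (x + a) - poly f x)"
  shows "degree f = 2"
proof -
  define d where "d = degree f"
  have "odd CARD('a)"
    using assms by (simp add: prime_odd_nat)
  then obtain m where m: "CARD('a) = 2 * m + 1"
    by (auto elim: oddE)
  have "m \<ge> 1" using m assms by simp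
  define D where "D = f \<circ>\<^sub>p [:1, 1:] - f"
  have D: "poly D = (\<lambda>x. poly f (x + 1) - poly f x)"
    by (auto simp: D_def poly_pcompose fun_eq_iff add.commute)
  have degD: "degree D = d - 1"
    unfolding D_def d_def using deg m by (intro degree_difference prime) auto
  have bijD: "bij (poly D)"
    unfolding D by (rule planar) simp
  have "d \<ge> 2"
  proof (rule ccontr)
    assume "\<not> d \<ge> 2"
    then obtain e where "D = [:e:]"
      using degD by (auto elim!: degree_eq_zeroE)
    then have "poly D 0 = poly D 1" by simp
    then show False
      using bijD by (metis bij_def inj_eq zero_neq_one)
  qed
  have mixed: "(\<Sum>x\<in>UNIV. poly f x ^ i * x ^ j) = 0" if "i + j < m" for i j
    using that m by (intro planar_mixed_moment_eq_0 prime planar) auto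
  have top: "i + j \<ge> m" if "i * d + j = 2 * m" for i j
  proof (rule ccontr)
    assume *: "\<not> i + j \<ge> m"
    let ?F = "f ^ i * monom 1 j"
    have "f \<noteq> 0" using \<open>d \<ge> 2\<close> by (auto simp: d_def)
    then have "degree ?F = 2 * m"
      using that by (simp add: degree_mult_eq degree_power_eq degree_monom_eq d_def)
    moreover from this have "coeff ?F (2 * m) \<noteq> 0"
      using \<open>m \<ge> 1\<close> by (metis leading_coeff_0_iff degree_0 mult_is_0 not_one_le_zero zero_neq_numeral)
    ultimately have "(\<Sum>x\<in>UNIV. poly ?F x) \<noteq> 0"
      using m by (subst sum_poly_eq) auto
    then show False
      using mixed[of i j] * by (simp add: poly_monom)
  qed
  have "d \<le> m + 1"
    using top[of 1 "2 * m - d"] deg m by (auto simp: d_def)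
  \<comment> \<open>The exponent 2 must lie below \<open>p - 1 = 2 * m\<close>. For
    \<open>m = 1\<close> the value \<open>m + 1\<close> is the desired 2.\<close>
  moreover have "d \<noteq> m + 1" if "m \<ge> 2"
  proof
    assume "d = m + 1"
    then have "degree (D ^ 2) = 2 * m"
      using degD \<open>m \<ge> 1\<close> by (subst degree_power_eq) auto
    moreover from this have "coeff (D ^ 2) (2 * m) \<noteq> 0"
      using \<open>m \<ge> 1\<close> by (metis leading_coeff_0_iff degree_0 mult_is_0 not_one_le_zero zero_neq_numeral)
    ultimately have "(\<Sum>x\<in>UNIV. poly (D ^ 2) x) \<noteq> 0"
      using m by (subst sum_poly_eq) auto
    moreover have "(\<Sum>x\<in>UNIV. poly D x ^ 2) = (\<Sum>z\<in>UNIV. z ^ 2)"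
      by (rule sum.reindex_bij_betw[OF bijD])
    ultimately show False
      using that m sum_power_eq_0[of 2, where 'a = 'a] by simp
  qed
  moreover have "\<not> d \<ge> 3" if "d \<le> m"
  proof
    assume "d \<ge> 3"
    define q j where "q = (2 * m) div d" and "j = (2 * m) mod d"
    have qj: "q * d + j = 2 * m"
      by (simp add: q_def j_def)
    have "j < d"
      using \<open>d \<ge> 3\<close> by (simp add: j_def)
    have "q \<ge> 2"
      using that \<open>d \<ge> 3\<close> by (simp add: q_def less_eq_div_iff_mult_less_eq)
    obtain e where e: "d = e + 3"
      using \<open>d \<ge> 3\<close> by (metis add.commute le_Suc_ex)
    \<comment> \<open>Doubling \<open>q + j \<ge> m\<close> and subtracting
      \<open>q * d + j = 2 * m\<close> leaves \<open>j \<ge> q * (d - 2)\<close>, while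
      \<open>j \<le> e + 2\<close>.\<close>
    have "q + q * e \<le> j"
      using top[OF qj] qj by (simp add: e algebra_simps)
    moreover have "2 * e \<le> q * e"
      using \<open>q \<ge> 2\<close> by simp
    ultimately have "e = 0" "q = 2" "j = 2"
      using \<open>q \<ge> 2\<close> \<open>j < d\<close> e by linarith+
    \<comment> \<open>the only numerical solution is \<open>p = 9\<close>\<close>
    then have "CARD('a) = 3 * 3"
      using qj m e by simp
    then show False
      using prime prime_product[of 3 3] by simp
  qed
  ultimately show ?thesis
    using \<open>d \<ge> 2\<close> \<open>m \<ge> 1\<close> unfolding d_def by linarith
qed

section \<open>Reduction to the planar case\<close>

lemma fin_diff_cong:
  assumes "\<And>i. i \<in> {1..k} \<Longrightarrow> a i = b i"
  shows "fin_diff k a f = fin_diff k b f"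
  using assms by (induction k) auto

lemma degree_fin_diff:
  fixes f :: "'a::{field, finite} poly"
  assumes "prime CARD('a)" "degree f < CARD('a)" "\<And>i. i \<in> {1..k} \<Longrightarrow> a i \<noteq> 0"
  shows "degree (fin_diff k a f) = degree f - k"
  using assms(3) by (induction k) (use assms(1,2) in \<open>auto simp: degree_difference\<close>)

theorem theorem1p2:
  fixes p k n :: nat
  assumes "prime p"
    and "CARD('a::{field, finite}) = p"
    and "k \<ge> 1"
    and "p \<ge> k + 2"
    and "n \<le> p - 1"
    and "k_PN k (monom (1::'a) n)"
  shows "n = k + 1"
proof -
  obtain l where l: "k = Suc l"
    using \<open>k \<ge> 1\<close> by (cases k) auto
  define g where "g = fin_diff l (\<lambda>_. 1) (monom (1::'a) n)"
  have deg: "degree g = n - l"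
    unfolding g_def using assms by (subst degree_fin_diff) (auto simp: degree_monom_eq)
  have "degree g = 2"
  proof (rule planar_poly_degree)
    fix b :: 'a assume "b \<noteq> 0"
    \<comment> \<open>Only the last direction varies; the first \<open>l\<close> stay 1, so they
      still produce \<open>g\<close>.\<close>
    define a where "a = (\<lambda>_. 1)(k := b)"
    have "bij (poly (fin_diff k a (monom 1 n)))"
      using assms \<open>b \<noteq> 0\<close> by (auto simp: k_PN_def a_def)
    moreover have "fin_diff l a (monom 1 n) = g"
      unfolding g_def by (rule fin_diff_cong) (simp add: a_def l)
    then have "poly (fin_diff k a (monom 1 n)) = (\<lambda>x. poly g (x + b) - poly g x)"
      by (auto simp: l poly_pcompose a_def add.commute)
    ultimately show "bij (\<lambda>x. poly g (x + b) - poly g x)" by simp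
  qed (use assms deg in auto)
  \<comment> \<open>As \<open>n - l = 2\<close> is nonzero, the subtraction is not truncated and
    \<open>n = l + 2\<close>.\<close>
  then show ?thesis
    using deg l by simp
qed

end
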